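(* Let $q\in\mathbb{C}$ with $0<|q|<1$. The incomplete $q$-Chebyshev polynomials of the first kind $\mathcal{T}_n^k=\mathcal{T}_n^k(x,s,q)$ satisfy, for all integers $n,k$ with $0\le k\le\frac{n-1}{2}$, $$\mathcal{T}_{n+2}^{k+1}=(1+q^{n+1})\,x\,\mathcal{T}_{n+1}^{k+1}+q^{n+1}s\,\mathcal{T}_{n}^{k}.$$
   Context: Notation: $[n]_q=\frac{1-q^n}{1-q}$, $[0]_q=0$; $(a;q)_0=1$ and $(a;q)_n=\prod_{i=0}^{n-1}(1-q^i a)$; $\begin{bmatrix} n\\k\end{bmatrix}_q=\frac{(q;q)_n}{(q;q)_{n-k}(q;q)_k}$ for $0\le k\le n$, and it is $0$ for $n<k$. Here $x,s$ are indeterminates. For $n\ge1$ and $0\le k\le\lfloor n/2\rfloor$, the incomplete $q$-Chebyshev polynomials of the first kind are $$\mathcal{T}_n^k(x,s,q)=\sum_{j=0}^{k}q^{j^2}\frac{[n]_q}{[n-j]_q}\begin{bmatrix} n-j\\ j\end{bmatrix}_q\frac{(-q;q)_{n-j-1}}{(-q;q)_j}\,s^jx^{n-2j}.$$ *)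

theory Defs
  imports Complex_Main "HOL-Computational_Algebra.Polynomial"
begin

definition q_number :: "complex \<Rightarrow> nat \<Rightarrow> complex" where
  "q_number q n = (1 - q ^ n) / (1 - q)"

definition q_pochhammer :: "complex \<Rightarrow> complex \<Rightarrow> nat \<Rightarrow> complex" where
  "q_pochhammer a q n = (\<Prod>i<n. (1 - q ^ i * a))"

definition q_binomial :: "complex \<Rightarrow> nat \<Rightarrow> nat \<Rightarrow> complex" where
  "q_binomial q n k =
     (if k \<le> n then q_pochhammer q q n / (q_pochhammer q q (n - k) * q_pochhammer q q k)
      else 0)"

text \<open>
  Polynomials in the two indeterminates \<open>x\<close> and \<open>s\<close> are elements of
  \<open>\<complex>[s][x]\<close>: the outer variable is \<open>x\<close>, the inner variable is \<open>s\<close>, and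
  \<open>[:[:c:]:]\<close> is the constant \<open>c\<close>.
\<close>

definition indet_x :: "complex poly poly" where
  "indet_x = [:0, 1:]"

definition indet_s :: "complex poly poly" where
  "indet_s = [:[:0, 1:]:]"

text \<open>
  The polynomials below are meant for \<open>n \<ge> 1\<close> and \<open>k \<le> n div 2\<close>; in this range none of the
  subtractions on natural numbers truncates. Outside it the value has no significance.
\<close>

definition incomplete_q_chebyshev_T :: "nat \<Rightarrow> nat \<Rightarrow> complex \<Rightarrow> complex poly poly" where
  "incomplete_q_chebyshev_T n k q =
     (\<Sum>j=0..k.
        [:[: q ^ (j ^ 2) * (q_number q n / q_number q (n - j)) * q_binomial q (n - j) j
             * (q_pochhammer (- q) q (n - j - 1) / q_pochhammer (- q) q j) :]:]
        * indet_s ^ j * indet_x ^ (n - 2 * j))"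

end

theory Submission imports Defs begin

text \<open>
  Both sides are compared coefficientwise. For \<open>j < n\<close> and \<open>2j \<le> n\<close> the factor
  \<open>1 - q\<^sup>n\<^sup>-\<^sup>j\<close> in the denominator of \<open>[n]\<^sub>q / [n-j]\<^sub>q\<close> cancels against the top factor of
  \<open>(q;q)\<^sub>n\<^sub>-\<^sub>j\<close>, so the coefficient of \<open>s\<^sup>j x\<^sup>n\<^sup>-\<^sup>2\<^sup>j\<close> in the incomplete polynomial equals
  \<open>q\<^bsup>j^2\<^esup> (1 - q\<^sup>n) (q;q)\<^sub>m (-q;q)\<^sub>m / ((q;q)\<^sub>n\<^sub>-\<^sub>2\<^sub>j (q;q)\<^sub>j (-q;q)\<^sub>j)\<close> with \<open>m = n - j - 1\<close>
  (\<open>cheb_coeff_eq\<close>). It does not depend on the truncation index \<open>k\<close>.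

  The coefficient of \<open>s\<^sup>0\<close> is \<open>(-q;q)\<^sub>n\<^sub>-\<^sub>1\<close>, and its recurrence is that of the \<open>q\<close>-Pochhammer
  symbol. For \<open>j = i + 1\<close> put \<open>a = q\<^sup>i\<close> and \<open>e = q\<^bsup>n - 2i - 1\<^esup>\<close>; after clearing
  common factors, the recurrence of the coefficients becomes the polynomial identity
  \<open>a\<^sup>2q (1 - a\<^sup>2eq\<^sup>3)(1 - a\<^sup>2e\<^sup>2q\<^sup>2) =
    a\<^sup>2q (1 - a\<^sup>4e\<^sup>2q\<^sup>4)(1 - eq) + a\<^sup>2eq\<^sup>2 (1 - a\<^sup>2eq)(1 - a\<^sup>2q\<^sup>2)\<close>
  (\<open>cheb_coeff_rec\<close>). The hypothesis on \<open>k\<close> says \<open>2k + 1 \<le> n\<close>, so every index that occurs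
  lies in the range where these formulas hold.
\<close>

text \<open>The coefficient of \<open>s\<^sup>j x\<^sup>n\<^sup>-\<^sup>2\<^sup>j\<close> in the \<open>q\<close>-Chebyshev polynomial of the first kind
  with index \<open>n\<close>, as it appears in the defining sum.\<close>
definition cheb_coeff :: "complex \<Rightarrow> nat \<Rightarrow> nat \<Rightarrow> complex" where
  "cheb_coeff q n j = q ^ (j ^ 2) * (q_number q n / q_number q (n - j)) * q_binomial q (n - j) j
             * (q_pochhammer (- q) q (n - j - 1) / q_pochhammer (- q) q j)"

lemma q_pochhammer_0 [simp]: "q_pochhammer a q 0 = 1"
  by (simp add: q_pochhammer_def)

lemma q_pochhammer_Suc [simp]: "q_pochhammer a q (Suc n) = q_pochhammer a q n * (1 - q ^ n * a)"
  by (simp add: q_pochhammer_def)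

lemma cmod_power_Suc_less_1:
  fixes q :: complex
  assumes "cmod q < 1"
  shows "cmod (q ^ Suc m) < 1"
  using power_Suc_less_one[of "cmod q" m] assms
  by (cases "q = 0") (auto simp: norm_power norm_mult)

lemma one_minus_power_neq_0:
  fixes q :: complex
  assumes "cmod q < 1"
  shows "1 - q ^ m * q \<noteq> 0"
  using cmod_power_Suc_less_1[OF assms, of m] by (auto simp: mult.commute)

lemma one_plus_power_neq_0:
  fixes q :: complex
  assumes "cmod q < 1"
  shows "1 + q ^ m * q \<noteq> 0"
proof
  assume "1 + q ^ m * q = 0"
  then have "q ^ Suc m = -1"
    by (simp add: eq_neg_iff_add_eq_0 mult.commute add.commute)
  then show False
    using cmod_power_Suc_less_1[OF assms, of m] by (simp del: power_Suc)
qed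

lemma q_pochhammer_self_neq_0:
  "cmod q < 1 \<Longrightarrow> q_pochhammer q q n \<noteq> 0"
  by (induction n) (auto dest: one_minus_power_neq_0)

lemma q_pochhammer_minus_self_neq_0:
  "cmod q < 1 \<Longrightarrow> q_pochhammer (- q) q n \<noteq> 0"
  by (induction n) (auto dest: one_plus_power_neq_0)

lemma cheb_coeff_eq:
  assumes q: "cmod q < 1" and "j < n" "2 * j \<le> n"
  shows "cheb_coeff q n j =
    q ^ (j ^ 2) * (1 - q ^ n) * (q_pochhammer q q (n - j - 1) * q_pochhammer (- q) q (n - j - 1)) /
    (q_pochhammer q q (n - 2 * j) * (q_pochhammer q q j * q_pochhammer (- q) q j))"
proof -
  define m where "m = n - j - 1"
  have m: "n - j = Suc m" "j \<le> Suc m" "Suc m - j = n - 2 * j"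
    using assms by (auto simp: m_def)
  have "1 - q \<noteq> 0"
    using q by auto
  then have "cheb_coeff q n j = q ^ (j ^ 2) * ((1 - q ^ n) / (1 - q ^ m * q)) *
      (q_pochhammer q q m * (1 - q ^ m * q) / (q_pochhammer q q (n - 2 * j) * q_pochhammer q q j)) *
      (q_pochhammer (- q) q m / q_pochhammer (- q) q j)"
    using m by (simp add: cheb_coeff_def q_number_def q_binomial_def mult.commute)
  then show ?thesis
    using one_minus_power_neq_0[OF q, of m] by (simp add: m_def mult.assoc)
qed

lemma cheb_coeff_0:
  assumes "cmod q < 1"
  shows "cheb_coeff q (Suc n) 0 = q_pochhammer (- q) q n"
  using assms one_minus_power_neq_0[OF assms, of n] q_pochhammer_self_neq_0[OF assms]
  by (simp add: cheb_coeff_eq mult.commute)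

lemma cheb_coeff_rec:
  assumes q: "cmod q < 1" and n: "2 * i + 1 \<le> n"
  shows "cheb_coeff q (n + 2) (Suc i) =
    (1 + q ^ (n + 1)) * cheb_coeff q (n + 1) (Suc i) + q ^ (n + 1) * cheb_coeff q n i"
proof -
  obtain d where d: "n = 2 * i + 1 + d"
    using n le_Suc_ex by blast
  define a e w where "a = q ^ i" and "e = q ^ d" and "w = q ^ (i ^ 2)"
  define A where "A = q_pochhammer q q (i + d) * q_pochhammer (- q) q (i + d)"
  define B where "B = q_pochhammer q q i * q_pochhammer (- q) q i"
  define D where "D = q_pochhammer q q d"
  have pw: "q ^ n = a ^ 2 * e * q" "q ^ (i + d) = a * e"
    "q ^ ((Suc i) ^ 2) = w * a ^ 2 * q"
    by (simp_all add: d a_def e_def w_def power_add power_mult power2_eq_square algebra_simps)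
  have c2: "cheb_coeff q (n + 2) (Suc i) =
      w * a ^ 2 * q * (1 - a ^ 2 * e * q * q ^ 2) * (A * (1 - (a * e * q) ^ 2)) /
      (D * (1 - e * q) * (B * (1 - (a * q) ^ 2)))"
  proof -
    have "Suc i < n + 2" "2 * Suc i \<le> n + 2"
      and idx: "n + 2 - Suc i - 1 = Suc (i + d)" "n + 2 - 2 * Suc i = Suc d"
      using d by auto
    from cheb_coeff_eq[OF q this(1,2)] show ?thesis
      unfolding idx pw power_add[of q n 2] q_pochhammer_Suc A_def B_def D_def
      by (simp add: a_def e_def power2_eq_square algebra_simps)
  qed
  have c1: "cheb_coeff q (n + 1) (Suc i) =
      w * a ^ 2 * q * (1 - a ^ 2 * e * q * q) * A / (D * (B * (1 - (a * q) ^ 2)))"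
  proof -
    have "Suc i < n + 1" "2 * Suc i \<le> n + 1"
      and idx: "n + 1 - Suc i - 1 = i + d" "n + 1 - 2 * Suc i = d"
      using d by auto
    from cheb_coeff_eq[OF q this(1,2)] show ?thesis
      unfolding idx pw power_add[of q n 1] q_pochhammer_Suc A_def B_def D_def
      by (simp add: a_def e_def power2_eq_square algebra_simps)
  qed
  have c0: "cheb_coeff q n i = w * (1 - a ^ 2 * e * q) * A / (D * (1 - e * q) * B)"
  proof -
    have "i < n" "2 * i \<le> n"
      and idx: "n - i - 1 = i + d" "n - 2 * i = Suc d"
      using d by auto
    from cheb_coeff_eq[OF q this(1,2)] show ?thesis
      unfolding idx pw q_pochhammer_Suc A_def B_def D_def w_def e_def
      by (simp add: mult.assoc)
  qed
  have B: "B \<noteq> 0" and D: "D \<noteq> 0"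
    using q_pochhammer_self_neq_0[OF q] q_pochhammer_minus_self_neq_0[OF q]
    by (simp_all add: B_def D_def)
  have E: "1 - e * q \<noteq> 0"
    using one_minus_power_neq_0[OF q, of d] by (simp add: e_def)
  have "1 - (a * q) ^ 2 = (1 - q ^ i * q) * (1 + q ^ i * q)"
    by (simp add: a_def power2_eq_square algebra_simps)
  then have F: "1 - (a * q) ^ 2 \<noteq> 0"
    using one_minus_power_neq_0[OF q, of i] one_plus_power_neq_0[OF q, of i] by simp
  \<comment> \<open>\<open>G\<close> is the common factor that reduces the claim to a polynomial identity.\<close>
  define G where "G = w * A / (D * (1 - e * q) * (B * (1 - (a * q) ^ 2)))"
  have "cheb_coeff q (n + 2) (Suc i) =
      G * (a ^ 2 * q * (1 - a ^ 2 * e * q * q ^ 2) * (1 - (a * e * q) ^ 2))"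
    unfolding c2 G_def by (simp add: mult_ac)
  moreover have "cheb_coeff q (n + 1) (Suc i) =
      G * (a ^ 2 * q * (1 - a ^ 2 * e * q * q) * (1 - e * q))"
    unfolding c1 G_def using E by (simp add: mult_ac)
  moreover have "cheb_coeff q n i = G * ((1 - a ^ 2 * e * q) * (1 - (a * q) ^ 2))"
    unfolding c0 G_def using F by (simp add: mult_ac)
  moreover have "q ^ (n + 1) = a ^ 2 * e * q * q"
    by (simp add: pw)
  ultimately show ?thesis
    by (simp only:) (simp add: power2_eq_square algebra_simps)
qed

lemma incomplete_q_chebyshev_T_eq_sum:
  "incomplete_q_chebyshev_T n k q =
     (\<Sum>j=0..k. [:[:cheb_coeff q n j:]:] * indet_s ^ j * indet_x ^ (n - 2 * j))"
  by (simp add: incomplete_q_chebyshev_T_def cheb_coeff_def)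

theorem theorem5:
  fixes q :: complex and n k :: nat
  assumes "0 < cmod q" and "cmod q < 1"
    and "real k \<le> (real n - 1) / 2"
  shows "incomplete_q_chebyshev_T (n + 2) (k + 1) q =
           [:[: 1 + q ^ (n + 1) :]:] * indet_x * incomplete_q_chebyshev_T (n + 1) (k + 1) q
           + [:[: q ^ (n + 1) :]:] * indet_s * incomplete_q_chebyshev_T n k q"
proof -
  have nk: "2 * k + 1 \<le> n"
    using assms(3) by (simp add: field_simps)
  define C :: "complex \<Rightarrow> complex poly poly" where "C c = [:[:c:]:]" for c
  have C: "C (u + v) = C u + C v" "C (u * v) = C u * C v" for u v
    by (simp_all add: C_def)
  define t where "t N j = C (cheb_coeff q N j) * indet_s ^ j * indet_x ^ (N - 2 * j)" for N j
  have T: "incomplete_q_chebyshev_T N K q = (\<Sum>j=0..K. t N j)" for N K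
    by (simp add: incomplete_q_chebyshev_T_eq_sum t_def C_def)
  have shift: "(\<Sum>j=0..k + 1. t N j) = t N 0 + (\<Sum>i=0..k. t N (Suc i))" for N
    by (simp add: sum.atLeast0_atMost_Suc_shift del: sum.cl_ivl_Suc)
  have "cheb_coeff q (n + 2) 0 = (1 + q ^ (n + 1)) * cheb_coeff q (n + 1) 0"
    using cheb_coeff_0[OF assms(2), of "Suc n"] cheb_coeff_0[OF assms(2), of n]
    by (simp add: algebra_simps)
  then have t0: "t (n + 2) 0 = C (1 + q ^ (n + 1)) * indet_x * t (n + 1) 0"
    by (simp add: t_def C(2) mult_ac)
  have t_Suc: "t (n + 2) (Suc i) = C (1 + q ^ (n + 1)) * indet_x * t (n + 1) (Suc i)
      + C (q ^ (n + 1)) * indet_s * t n i" if "i \<in> {0..k}" for i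
  proof -
    have i: "2 * i + 1 \<le> n"
      using that nk by simp
    have e: "n + 2 - 2 * Suc i = Suc (n + 1 - 2 * Suc i)" "n - 2 * i = Suc (n + 1 - 2 * Suc i)"
      using i by auto
    show ?thesis
      unfolding t_def cheb_coeff_rec[OF assms(2) i] C e power_Suc
      by (simp only: distrib_right distrib_left mult_ac)
  qed
  have "(\<Sum>j=0..k + 1. t (n + 2) j) =
      C (1 + q ^ (n + 1)) * indet_x * (\<Sum>j=0..k + 1. t (n + 1) j)
      + C (q ^ (n + 1)) * indet_s * (\<Sum>j=0..k. t n j)"
    unfolding shift t0 using t_Suc
    by (simp only: sum.distrib sum_distrib_left distrib_left add.assoc cong: sum.cong)
  then show ?thesis
    by (simp only: T C_def)
qed

end
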